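(* Let $g\ge 4$ be an even integer and let $m>g-1$ be an odd integer not divisible by $g-1$. Let $G_{m,g}=\{g^j \bmod m : j=0,1,2,\dots\}\subseteq \mathbb{Z}_m$. If at least one of the residues $-1,-2,\dots,-(g-2)$ modulo $m$, or at least one of the residues $2,3,\dots,g-1$ modulo $m$, belongs to $G_{m,g}$, then $m$ is complete (with respect to $g$).
   Context: Fix an even integer $g\ge4$. For an odd integer $m\ge1$, an extreme cycle for the digit set $\{0,m\}$ is a finite set of distinct integers $\{x_0,\dots,x_{r-1}\}$ together with digits $l_0,\dots,l_{r-1}\in\{0,m\}$ such that $x_{j+1}=(x_j+l_j)/g$ for $0\le j\le r-2$ and $x_0=(x_{r-1}+l_{r-1})/g$. The cycle $\{0\}$ (with digit $0$) is the trivial extreme cycle. The number $m$ is complete if the only extreme cycle for $\{0,m\}$ is the trivial one, and incomplete otherwise. *)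

theory Defs
  imports Complex_Main
begin

text \<open>
  A cycle is given by the list of its points together with the list of its digits, both indexed
  from 0. The division is that of the reals, so the recurrence includes the requirement
  that \<open>x\<^sub>j + l\<^sub>j\<close> is divisible by \<open>g\<close>.
\<close>

definition extreme_cycle :: "int \<Rightarrow> int \<Rightarrow> int list \<Rightarrow> int list \<Rightarrow> bool" where
  "extreme_cycle g m xs ls \<longleftrightarrow>
     xs \<noteq> [] \<and> length ls = length xs \<and> distinct xs \<and> set ls \<subseteq> {0, m} \<and>
     (\<forall>j. Suc j < length xs \<longrightarrow>
        real_of_int (xs ! Suc j) = (real_of_int (xs ! j) + real_of_int (ls ! j)) / real_of_int g) \<and>
     real_of_int (xs ! 0) =
       (real_of_int (xs ! (length xs - 1)) + real_of_int (ls ! (length xs - 1))) / real_of_int g"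

lemma extreme_cycle_trivial: "extreme_cycle g m [0] [0]"
  by (simp add: extreme_cycle_def)

definition complete_number :: "int \<Rightarrow> int \<Rightarrow> bool" where
  "complete_number g m \<longleftrightarrow> {(xs, ls). extreme_cycle g m xs ls} = {([0], [0])}"

text \<open>Elements of \<open>\<int>\<^sub>m\<close> are represented by their residues in \<open>{0..<m}\<close>.\<close>

definition power_residues :: "int \<Rightarrow> int \<Rightarrow> int set" where
  "power_residues m g = {g ^ j mod m | j :: nat. True}"

end

theory Submission
  imports Defs
begin

text \<open>
  Read backwards, a cycle is an orbit of multiplication by \<open>g\<close> modulo \<open>m\<close>, and all of its points
  lie in \<open>[0, m / (g - 1))\<close>; so its set of points is closed under multiplication modulo \<open>m\<close> by every
  element of \<open>G\<^bsub>m,g\<^esub>\<close>. A residue \<open>k \<in> {2..g - 1}\<close> sends the largest point \<open>x > 0\<close> to \<open>k x > x\<close>,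
  and a residue \<open>- k\<close> with \<open>k \<le> g - 2\<close> sends \<open>x > 0\<close> to \<open>m - k x > m / (g - 1)\<close>. Neither is possible.
\<close>

text \<open>Replaces real division by an integer equation and forgets the order of the points and
  the digits. The remaining lemmas need only a finite set closed under taking predecessors.\<close>

lemma extreme_cycle_predecessor:
  assumes "extreme_cycle g m xs ls" and "g \<noteq> 0" and "y \<in> set xs"
  obtains x where "x \<in> set xs" and "g * y = x \<or> g * y = x + m"
proof -
  let ?n = "length xs"
  have len: "length ls = ?n" and dig: "set ls \<subseteq> {0, m}" and "xs \<noteq> []"
    and step: "\<And>j. Suc j < ?n \<Longrightarrow> real_of_int (xs ! Suc j) = (real_of_int (xs ! j) + real_of_int (ls ! j)) / real_of_int g"
    and last: "real_of_int (xs ! 0) = (real_of_int (xs ! (?n - 1)) + real_of_int (ls ! (?n - 1))) / real_of_int g"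
    using assms(1) by (auto simp: extreme_cycle_def)
  obtain i where i: "i < ?n" "xs ! i = y"
    using assms(3) by (auto simp: in_set_conv_nth)
  \<comment> \<open>Indices are cyclic: the point before index 0 is the last one, and there the
    closing equation of the cycle takes the place of the recurrence.\<close>
  define j where "j = (if i = 0 then ?n - 1 else i - 1)"
  have j: "j < ?n" using i by (auto simp: j_def)
  have "real_of_int y = (real_of_int (xs ! j) + real_of_int (ls ! j)) / real_of_int g"
    using step[of "i - 1"] last i by (cases "i = 0") (auto simp: j_def)
  hence "real_of_int (g * y) = real_of_int (xs ! j + ls ! j)"
    using \<open>g \<noteq> 0\<close> by (simp add: field_simps)
  hence "g * y = xs ! j + ls ! j" by linarith
  moreover have "ls ! j \<in> {0, m}" using dig j len by (metis nth_mem subsetD)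
  ultimately show thesis using that[of "xs ! j"] j by auto
qed

text \<open>Extremal argument. The predecessor of the minimum is at least the minimum, which gives
  \<open>(g - 1) * Min C \<ge> 0\<close>; the predecessor of the maximum is at most the maximum,
  which gives \<open>(g - 1) * Max C \<le> m\<close>.\<close>

lemma backward_closed_bounds:
  fixes C :: "int set"
  assumes "finite C" and "g > 1" and "m \<ge> 0"
    and pred: "\<And>y. y \<in> C \<Longrightarrow> \<exists>x\<in>C. g * y = x \<or> g * y = x + m"
    and "y \<in> C"
  shows "0 \<le> y" and "(g - 1) * y \<le> m"
proof -
  have ne: "C \<noteq> {}" using assms by auto
  obtain a where a: "a \<in> C" "g * Min C = a \<or> g * Min C = a + m"
    using pred[of "Min C"] \<open>finite C\<close> ne by auto
  have "Min C \<le> a" using a \<open>finite C\<close> by auto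
  hence "0 \<le> (g - 1) * Min C" using a \<open>m \<ge> 0\<close> by (auto simp: algebra_simps)
  hence "0 \<le> Min C" using \<open>g > 1\<close> by (simp add: zero_le_mult_iff)
  thus "0 \<le> y" using \<open>finite C\<close> \<open>y \<in> C\<close> by (meson Min_le order_trans)
  obtain b where b: "b \<in> C" "g * Max C = b \<or> g * Max C = b + m"
    using pred[of "Max C"] \<open>finite C\<close> ne by auto
  have "b \<le> Max C" using b \<open>finite C\<close> by auto
  hence "(g - 1) * Max C \<le> m" using b \<open>m \<ge> 0\<close> by (auto simp: algebra_simps)
  moreover have "(g - 1) * y \<le> (g - 1) * Max C"
    using \<open>finite C\<close> \<open>y \<in> C\<close> \<open>g > 1\<close> by (intro mult_left_mono) auto
  ultimately show "(g - 1) * y \<le> m" by linarith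
qed

text \<open>A predecessor of \<open>y\<close> is congruent to \<open>g * y\<close> modulo
  \<open>m\<close> and lies in \<open>{0..<m}\<close>, so it equals the residue of
  \<open>g * y\<close>; iterate.\<close>

lemma backward_closed_power:
  fixes C :: "int set"
  assumes "C \<subseteq> {0..<m}"
    and pred: "\<And>y. y \<in> C \<Longrightarrow> \<exists>x\<in>C. g * y = x \<or> g * y = x + m"
    and "y \<in> C"
  shows "g ^ j * y mod m \<in> C"
proof (induction j)
  case 0
  thus ?case using assms by auto
next
  case (Suc j)
  obtain x where x: "x \<in> C" "g * (g ^ j * y mod m) = x \<or> g * (g ^ j * y mod m) = x + m"
    using pred[OF Suc] by blast
  hence "x = g * (g ^ j * y mod m) mod m" using \<open>C \<subseteq> {0..<m}\<close> by auto
  also have "\<dots> = g ^ Suc j * y mod m" by (simp add: mod_simps mult.assoc)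
  finally show ?case using x by simp
qed

lemma backward_closed_zero:
  fixes C :: "int set"
  assumes "finite C" and "g > 1" and "m > 0" and ndvd: "\<not> (g - 1) dvd m"
    and pred: "\<And>y. y \<in> C \<Longrightarrow> \<exists>x\<in>C. g * y = x \<or> g * y = x + m"
    and res: "(\<exists>k\<in>{1..g - 2}. (- k) mod m \<in> power_residues m g) \<or>
              (\<exists>k\<in>{2..g - 1}. k mod m \<in> power_residues m g)"
  shows "C \<subseteq> {0}"
proof (rule ccontr)
  assume "\<not> C \<subseteq> {0}"
  have nonneg: "0 \<le> y" if "y \<in> C" for y
    using backward_closed_bounds(1)[OF assms(1,2) _ pred that] \<open>m > 0\<close> by simp
  have bound: "(g - 1) * y < m" if "y \<in> C" for y
  proof -
    have "(g - 1) * y \<le> m"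
      using backward_closed_bounds(2)[OF assms(1,2) _ pred that] \<open>m > 0\<close> by simp
    \<comment> \<open>Equality would exhibit \<open>m\<close> as a multiple of
      \<open>g - 1\<close>.\<close>
    moreover have "(g - 1) * y \<noteq> m" using ndvd by (metis dvd_triv_left)
    ultimately show ?thesis by simp
  qed
  have scaled: "k * y \<le> (g - 1) * y" if "y \<in> C" "k \<le> g - 1" for k y
    using that nonneg by (intro mult_right_mono) auto
  have "C \<subseteq> {0..<m}"
    using nonneg bound scaled[of _ 1] \<open>g > 1\<close> by fastforce
  have closed: "k * y mod m \<in> C" if "y \<in> C" and k: "k mod m \<in> power_residues m g" for k y
  proof -
    obtain j where "k mod m = g ^ j mod m"
      using k by (auto simp: power_residues_def)
    hence "k * y mod m = g ^ j * y mod m" by (metis mod_mult_left_eq)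
    thus ?thesis using backward_closed_power[OF \<open>C \<subseteq> {0..<m}\<close> pred \<open>y \<in> C\<close>] by simp
  qed
  define x where "x = Max C"
  have "C \<noteq> {}" using \<open>\<not> C \<subseteq> {0}\<close> by blast
  hence "x \<in> C" and x_max: "\<And>y. y \<in> C \<Longrightarrow> y \<le> x"
    using \<open>finite C\<close> by (auto simp: x_def)
  have "x > 0"
    using \<open>\<not> C \<subseteq> {0}\<close> nonneg x_max by force
  from res show False
  proof (elim disjE bexE)
    fix k assume k: "k \<in> {1..g - 2}" "(- k) mod m \<in> power_residues m g"
    \<comment> \<open>As \<open>(g - 2) * x + x = (g - 1) * x < m\<close>, the number
      \<open>m - k * x\<close> exceeds \<open>x\<close>. It is also below \<open>m\<close>, so it is
      the residue of \<open>- k * x\<close>, and closure puts it in \<open>C\<close> above the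
      maximum.\<close>
    have "k * x \<le> (g - 2) * x" using k \<open>x > 0\<close> by simp
    hence gap: "x < m - k * x"
      using bound[OF \<open>x \<in> C\<close>] by (simp add: algebra_simps)
    moreover have "0 < k * x" using k \<open>x > 0\<close> by simp
    ultimately have "(m - k * x) mod m = m - k * x"
      using \<open>x > 0\<close> by (intro mod_pos_pos_trivial) auto
    moreover have "(m - k * x) mod m = (- k) * x mod m" by simp
    ultimately show False using closed[OF \<open>x \<in> C\<close> k(2)] x_max gap by fastforce
  next
    fix k assume k: "k \<in> {2..g - 1}" "k mod m \<in> power_residues m g"
    have "0 \<le> k * x" using k \<open>x > 0\<close> by simp
    \<comment> \<open>No reduction modulo \<open>m\<close> takes place, so \<open>k * x\<close>
      itself is a point of \<open>C\<close>.\<close>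
    moreover have "k * x < m" using scaled[OF \<open>x \<in> C\<close>, of k] bound[OF \<open>x \<in> C\<close>] k by simp
    ultimately have "k * x \<in> C" using closed[OF \<open>x \<in> C\<close> k(2)] by simp
    moreover have "k * x \<ge> 2 * x" using k \<open>x > 0\<close> by simp
    ultimately show False using x_max[of "k * x"] \<open>x > 0\<close> by simp
  qed
qed

theorem theorem2p12:
  fixes g m :: int
  assumes "even g" and "g \<ge> 4"
    and "odd m" and "m > g - 1" and "\<not> (g - 1) dvd m"
    and "(\<exists>k\<in>{1..g - 2}. (- k) mod m \<in> power_residues m g) \<or>
         (\<exists>k\<in>{2..g - 1}. k mod m \<in> power_residues m g)"
  shows "complete_number g m"
proof -
  have "xs = [0] \<and> ls = [0]" if cycle: "extreme_cycle g m xs ls" for xs ls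
  proof -
    have "\<exists>x\<in>set xs. g * y = x \<or> g * y = x + m" if "y \<in> set xs" for y
      using extreme_cycle_predecessor[OF cycle _ that] assms(2) by (metis not_numeral_le_zero)
    hence "set xs \<subseteq> {0}"
      using assms by (intro backward_closed_zero[of "set xs" g m]) auto
    moreover have "xs \<noteq> []" "distinct xs" "length ls = length xs"
      using cycle by (auto simp: extreme_cycle_def)
    ultimately have "xs = [0]"
      by (cases xs; cases "tl xs") auto
    moreover obtain l where "ls = [l]"
      using \<open>length ls = length xs\<close> \<open>xs = [0]\<close> by (cases ls) auto
    \<comment> \<open>For a single point 0 the closing equation reads
      \<open>0 = (0 + l) / g\<close>, which forces the digit to be 0.\<close>
    ultimately show ?thesis
      using cycle assms(2) by (auto simp: extreme_cycle_def)
  qed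
  thus ?thesis
    unfolding complete_number_def using extreme_cycle_trivial by auto
qed

end
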